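(* Let $(E,\rho)$ be a complete metric space, $-\infty<a<b<+\infty$ and $f:[a;b]\rightarrow E$. The following properties are equivalent: (a) $f$ is regulated; (b) $f$ is a uniform limit of finite variation functions from $[a;b]$ to $E$; (c) for any $c>0$, $TV^{c}(f,[a;b])<+\infty$.
   Context: A function $f:[a;b]\to E$ is called regulated if for every $s\in(a;b)$ it has left and right limits $f(s-)$, $f(s+)$ (in $E$), and the limits $f(a+)$ and $f(b-)$ exist. The total variation of $g:[a;b]\to E$ is $TV(g,[a;b])=\sup_n\sup_{a\leq t_0<\ldots<t_n\leq b}\sum_{i=1}^n\rho(g(t_i),g(t_{i-1}))$; $g$ is a finite variation function if $TV(g,[a;b])<+\infty$. The truncated variation of $f$ at the level $c>0$ is $TV^c(f,[a;b])=\sup_n\sup_{a\leq t_0<\ldots<t_n\leq b}\sum_{i=1}^n\max\{\rho(f(t_i),f(t_{i-1}))-c,0\}$. *)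

theory Defs
  imports "HOL-Analysis.Analysis"
begin

text \<open>
  A function \<open>[a;b] \<rightarrow> E\<close> is represented by a total function on the reals; every
  definition below depends only on its values on \<open>{a..b}\<close> (for \<open>a < b\<close>).
\<close>

definition regulated :: "real \<Rightarrow> real \<Rightarrow> (real \<Rightarrow> 'a::metric_space) \<Rightarrow> bool" where
  "regulated a b f \<longleftrightarrow>
     (\<forall>s\<in>{a<..<b}. (\<exists>l. (f \<longlongrightarrow> l) (at_left s)) \<and> (\<exists>r. (f \<longlongrightarrow> r) (at_right s))) \<and>
     (\<exists>r. (f \<longlongrightarrow> r) (at_right a)) \<and> (\<exists>l. (f \<longlongrightarrow> l) (at_left b))"

text \<open>
  A pair \<open>(n, t)\<close> encodes \<open>a \<le> t 0 < \<dots> < t n \<le> b\<close>; the values of \<open>t\<close> beyond \<open>n\<close> are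
  irrelevant. The degenerate case \<open>n = 0\<close> contributes the empty sum, which does not
  affect a supremum of nonnegative values.
\<close>

definition grids :: "real \<Rightarrow> real \<Rightarrow> (nat \<times> (nat \<Rightarrow> real)) set" where
  "grids a b = {(n, t). a \<le> t 0 \<and> strict_mono_on {0..n} t \<and> t n \<le> b}"

definition total_variation ::
  "real \<Rightarrow> real \<Rightarrow> (real \<Rightarrow> 'a::metric_space) \<Rightarrow> ennreal" where
  "total_variation a b g =
     (SUP (n, t)\<in>grids a b. ennreal (\<Sum>i=1..n. dist (g (t i)) (g (t (i - 1)))))"

definition finite_variation :: "real \<Rightarrow> real \<Rightarrow> (real \<Rightarrow> 'a::metric_space) \<Rightarrow> bool" where
  "finite_variation a b g \<longleftrightarrow> total_variation a b g < \<infinity>"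

definition truncated_variation ::
  "real \<Rightarrow> real \<Rightarrow> real \<Rightarrow> (real \<Rightarrow> 'a::metric_space) \<Rightarrow> ennreal" where
  "truncated_variation c a b f =
     (SUP (n, t)\<in>grids a b.
        ennreal (\<Sum>i=1..n. max (dist (f (t i)) (f (t (i - 1))) - c) 0))"

definition uniform_limit_of_finite_variation ::
  "real \<Rightarrow> real \<Rightarrow> (real \<Rightarrow> 'a::metric_space) \<Rightarrow> bool" where
  "uniform_limit_of_finite_variation a b f \<longleftrightarrow>
     (\<exists>g :: nat \<Rightarrow> real \<Rightarrow> 'a.
        (\<forall>n. finite_variation a b (g n)) \<and> uniform_limit {a..b} g f sequentially)"

end

theory Submission
  imports Defs
begin

text \<open>
  (b) implies (c): if \<open>g\<close> is \<open>c/2\<close>-close to \<open>f\<close>, every truncated increment of \<open>f\<close> at level \<open>c\<close>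
  is at most the corresponding increment of \<open>g\<close>.
  (c) implies (a): by completeness, a missing one-sided limit yields infinitely many pairwise
  separated intervals on whose endpoints \<open>f\<close> differs by at least some \<open>e > 0\<close>, and these make the
  truncated variation at level \<open>e/2\<close> infinite.
  (a) implies (b): near each point, \<open>f\<close> is uniformly close to a step function, and local
  approximants glue by compactness of \<open>{a..b}\<close>.
\<close>

section \<open>Finite variations as real bounds over grids\<close>

lemma SUP_ennreal_finite_iff:
  fixes S :: "'b \<Rightarrow> real"
  assumes "A \<noteq> {}"
  shows "(SUP x\<in>A. ennreal (S x)) < \<infinity> \<longleftrightarrow> (\<exists>B. \<forall>x\<in>A. S x \<le> B)"
proof
  assume fin: "(SUP x\<in>A. ennreal (S x)) < \<infinity>"
  have "S x \<le> enn2real (SUP x\<in>A. ennreal (S x))" if "x \<in> A" for x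
  proof -
    have "ennreal (S x) \<le> (SUP x\<in>A. ennreal (S x))"
      using that by (rule SUP_upper)
    also have "\<dots> = ennreal (enn2real (SUP x\<in>A. ennreal (S x)))"
      using fin by simp
    \<comment> \<open>Since \<open>enn2real\<close> is nonnegative, \<open>ennreal\<close> reflects
      this inequality even if \<open>S x\<close> is negative.\<close>
    finally show ?thesis
      by simp
  qed
  then show "\<exists>B. \<forall>x\<in>A. S x \<le> B" by blast
next
  assume "\<exists>B. \<forall>x\<in>A. S x \<le> B"
  then obtain B where "\<And>x. x \<in> A \<Longrightarrow> S x \<le> B" by blast
  then have "(SUP x\<in>A. ennreal (S x)) \<le> ennreal B"
    by (intro SUP_least ennreal_leI)
  then show "(SUP x\<in>A. ennreal (S x)) < \<infinity>"
    using ennreal_less_top le_less_trans infinity_ennreal_def by metis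
qed

lemma grids_nonempty: "a \<le> b \<Longrightarrow> grids a b \<noteq> {}"
  by (auto simp: grids_def intro!: exI[of _ "0::nat"] exI[of _ "\<lambda>_. a"] strict_mono_onI)

lemma grids_bounds:
  assumes "(n, t) \<in> grids a b" "i \<le> n"
  shows "a \<le> t i" "t i \<le> b"
proof -
  have sm: "strict_mono_on {0..n} t" and "a \<le> t 0" "t n \<le> b"
    using assms(1) by (auto simp: grids_def)
  moreover have "t 0 \<le> t i" "t i \<le> t n"
    using strict_mono_on_leD[OF sm, of 0 i] strict_mono_on_leD[OF sm, of i n] assms(2) by auto
  ultimately show "a \<le> t i" "t i \<le> b" by linarith+
qed

lemma grids_step:
  assumes "(n, t) \<in> grids a b" "i \<in> {1..n}"
  shows "t (i - 1) \<le> t i"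
proof -
  have "strict_mono_on {0..n} t"
    using assms(1) by (auto simp: grids_def)
  from strict_mono_on_leD[OF this, of "i - 1" i] assms(2) show ?thesis by auto
qed

lemma finite_variation_iff:
  assumes "a \<le> b"
  shows "finite_variation a b g \<longleftrightarrow>
    (\<exists>B. \<forall>(n, t)\<in>grids a b. (\<Sum>i=1..n. dist (g (t i)) (g (t (i - 1)))) \<le> B)"
  unfolding finite_variation_def total_variation_def
  using SUP_ennreal_finite_iff[OF grids_nonempty[OF assms],
      of "\<lambda>(n, t). \<Sum>i=1..n. dist (g (t i)) (g (t (i - 1)))"]
  by (simp add: case_prod_unfold)

lemma truncated_variation_finite_iff:
  assumes "a \<le> b"
  shows "truncated_variation c a b f < \<infinity> \<longleftrightarrow>
    (\<exists>B. \<forall>(n, t)\<in>grids a b. (\<Sum>i=1..n. max (dist (f (t i)) (f (t (i - 1))) - c) 0) \<le> B)"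
  unfolding truncated_variation_def
  using SUP_ennreal_finite_iff[OF grids_nonempty[OF assms],
      of "\<lambda>(n, t). \<Sum>i=1..n. max (dist (f (t i)) (f (t (i - 1))) - c) 0"]
  by (simp add: case_prod_unfold)

section \<open>Controlling variation by a real function\<close>

text \<open>For \<open>g\<close> of finite variation, the variation of \<open>g\<close> on [a;x] as
  a function of x is such an \<open>h\<close>. Unlike a supremum over grids, an \<open>h\<close> can
  be written down for step functions and glued across adjacent intervals.\<close>

definition dominated_by_increments ::
  "real \<Rightarrow> real \<Rightarrow> (real \<Rightarrow> 'a::metric_space) \<Rightarrow> (real \<Rightarrow> real) \<Rightarrow> bool" where
  "dominated_by_increments a b g h \<longleftrightarrow>
    (\<forall>x y. a \<le> x \<longrightarrow> x \<le> y \<longrightarrow> y \<le> b \<longrightarrow> dist (g x) (g y) \<le> h y - h x)"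

text \<open>The increments of \<open>h\<close> telescope along a grid, and \<open>h\<close> is
  monotone because distances are nonnegative, so \<open>h b - h a\<close> bounds every sum.\<close>

lemma dominated_by_increments_imp_finite_variation:
  assumes "a \<le> b" and dom: "dominated_by_increments a b g h"
  shows "finite_variation a b g"
proof -
  have mono: "h x \<le> h y" if "a \<le> x" "x \<le> y" "y \<le> b" for x y
    using dom that zero_le_dist[of "g x" "g y"]
    unfolding dominated_by_increments_def by (meson diff_ge_0_iff_ge order_trans)
  have "(\<Sum>i=1..n. dist (g (t i)) (g (t (i - 1)))) \<le> h b - h a" if "(n, t) \<in> grids a b" for n t
  proof -
    have "(\<Sum>i=1..n. dist (g (t i)) (g (t (i - 1)))) \<le> (\<Sum>i=1..n. h (t i) - h (t (i - 1)))"
    proof (rule sum_mono)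
      fix i assume i: "i \<in> {1..n}"
      then have "a \<le> t (i - 1)" "t (i - 1) \<le> t i" "t i \<le> b"
        using grids_bounds[OF that] grids_step[OF that] by auto
      then show "dist (g (t i)) (g (t (i - 1))) \<le> h (t i) - h (t (i - 1))"
        using dom unfolding dominated_by_increments_def by (metis dist_commute)
    qed
    also have "\<dots> = h (t n) - h (t 0)"
      by (induction n) auto
    also have "\<dots> \<le> h b - h a"
      using mono[of "t n" b] mono[of a "t 0"] grids_bounds[OF that, of 0] grids_bounds[OF that, of n]
      by simp
    finally show ?thesis .
  qed
  then show ?thesis
    using finite_variation_iff[OF assms(1)] by blast
qed

text \<open>The glued function may jump just to the right of \<open>v\<close>, from
  \<open>g v\<close> towards \<open>g' v\<close>. The glued control is therefore \<open>h'\<close>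
  shifted by a constant so that the crossing costs \<open>dist (g v) (g' v)\<close>; for
  \<open>x \<le> v < y\<close> the triangle inequality runs through \<open>g v\<close> and
  \<open>g' v\<close>.\<close>

lemma dominated_by_increments_glue:
  assumes g: "dominated_by_increments u v g h" and g': "dominated_by_increments v w g' h'"
    and "u \<le> v" "v \<le> w"
  shows "dominated_by_increments u w (\<lambda>x. if x \<le> v then g x else g' x)
    (\<lambda>x. if x \<le> v then h x else h v + dist (g v) (g' v) + (h' x - h' v))"
  unfolding dominated_by_increments_def
proof (intro allI impI)
  fix x y assume xy: "u \<le> x" "x \<le> y" "y \<le> w"
  consider "y \<le> v" | "x \<le> v" "v < y" | "v < x" by linarith
  then show "dist (if x \<le> v then g x else g' x) (if y \<le> v then g y else g' y)
    \<le> (if y \<le> v then h y else h v + dist (g v) (g' v) + (h' y - h' v)) -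
      (if x \<le> v then h x else h v + dist (g v) (g' v) + (h' x - h' v))"
  proof cases
    case 1
    then show ?thesis using g xy by (auto simp: dominated_by_increments_def)
  next
    case 2
    have "dist (g x) (g' y) \<le> dist (g x) (g v) + dist (g v) (g' v) + dist (g' v) (g' y)"
      by metric
    moreover have "dist (g x) (g v) \<le> h v - h x"
      using g xy 2 by (auto simp: dominated_by_increments_def)
    moreover have "dist (g' v) (g' y) \<le> h' y - h' v"
      using g' xy 2 by (auto simp: dominated_by_increments_def)
    ultimately show ?thesis using 2 by simp
  next
    case 3
    then have "dist (g' x) (g' y) \<le> h' y - h' x"
      using g' xy by (auto simp: dominated_by_increments_def)
    with 3 xy show ?thesis by simp
  qed
qed

section \<open>Approximation of regulated functions\<close>

lemma regulated_near_limits: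
  assumes reg: "regulated a b f" and x: "x \<in> {a..b}" and "a < b" "0 < e"
  obtains l r d where "0 < d"
    "\<And>y. a \<le> y \<Longrightarrow> y < x \<Longrightarrow> x - y < d \<Longrightarrow> dist l (f y) < e"
    "\<And>y. y \<le> b \<Longrightarrow> x < y \<Longrightarrow> y - x < d \<Longrightarrow> dist r (f y) < e"
proof -
  have "\<exists>l d. 0 < d \<and> (\<forall>y. a \<le> y \<longrightarrow> y < x \<longrightarrow> x - y < d \<longrightarrow> dist l (f y) < e)"
  proof (cases "x = a")
    case True
    \<comment> \<open>No \<open>y\<close> satisfies both \<open>a \<le> y\<close> and
      \<open>y < a\<close>, so any \<open>l\<close> will do.\<close>
    then show ?thesis by (auto intro!: exI[of _ "1::real"])
  next
    case False
    then have "\<exists>l. (f \<longlongrightarrow> l) (at_left x)"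
      using reg x \<open>a < b\<close> by (cases "x = b") (auto simp: regulated_def)
    then obtain l where "eventually (\<lambda>y. dist (f y) l < e) (at_left x)"
      using \<open>0 < e\<close> tendstoD by blast
    then obtain p where "p < x" "\<forall>y>p. y < x \<longrightarrow> dist (f y) l < e"
      unfolding eventually_at_left_field by blast
    then show ?thesis
      by (intro exI[of _ l] exI[of _ "x - p"]) (auto simp: dist_commute)
  qed
  moreover have "\<exists>r d. 0 < d \<and> (\<forall>y. y \<le> b \<longrightarrow> x < y \<longrightarrow> y - x < d \<longrightarrow> dist r (f y) < e)"
  proof (cases "x = b")
    case True
    then show ?thesis by (auto intro!: exI[of _ "1::real"])
  next
    case False
    then have "\<exists>r. (f \<longlongrightarrow> r) (at_right x)"
      using reg x \<open>a < b\<close> by (cases "x = a") (auto simp: regulated_def)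
    then obtain r where "eventually (\<lambda>y. dist (f y) r < e) (at_right x)"
      using \<open>0 < e\<close> tendstoD by blast
    then obtain q where "x < q" "\<forall>y>x. y < q \<longrightarrow> dist (f y) r < e"
      unfolding eventually_at_right_field by blast
    then show ?thesis
      by (intro exI[of _ r] exI[of _ "q - x"]) (auto simp: dist_commute)
  qed
  ultimately obtain l d1 r d2 where "0 < d1" "0 < d2"
    "\<forall>y. a \<le> y \<longrightarrow> y < x \<longrightarrow> x - y < d1 \<longrightarrow> dist l (f y) < e"
    "\<forall>y. y \<le> b \<longrightarrow> x < y \<longrightarrow> y - x < d2 \<longrightarrow> dist r (f y) < e"
    by blast
  then show ?thesis
    by (intro that[of "min d1 d2" l r]) auto
qed

text \<open>Compactness enters as the bisection principle \<open>Bolzano\<close>: a property of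
  intervals that passes to the union of two adjacent intervals and holds for all short intervals
  around each point holds for [a;b].\<close>

lemma regulated_approx:
  assumes reg: "regulated a b f" and "a < b" "0 < e"
  obtains g where "finite_variation a b g" "\<And>x. x \<in> {a..b} \<Longrightarrow> dist (g x) (f x) < e"
proof -
  \<comment> \<open>The property asks for a control \<open>h\<close> rather than finite variation,
    so that gluing applies. The guards \<open>a \<le> u\<close> and \<open>v \<le> b\<close> are
    there because the short intervals in \<open>Bolzano\<close> may stick out of [a;b], where
    nothing is known about \<open>f\<close>.\<close>
  define P where "P u v \<longleftrightarrow> a \<le> u \<longrightarrow> v \<le> b \<longrightarrow>
    (\<exists>g h. dominated_by_increments u v g h \<and> (\<forall>x\<in>{u..v}. dist (g x) (f x) < e))" for u v
  have "P a b"
  proof (rule Bolzano)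
    show "a \<le> b" using \<open>a < b\<close> by simp
  next
    fix u v w assume P: "P u v" "P v w" and le: "u \<le> v" "v \<le> w"
    show "P u w"
      unfolding P_def
    proof (intro impI)
      assume uw: "a \<le> u" "w \<le> b"
      obtain g h where g: "dominated_by_increments u v g h" "\<forall>x\<in>{u..v}. dist (g x) (f x) < e"
        using P(1) le uw by (auto simp: P_def)
      obtain g' h' where g': "dominated_by_increments v w g' h'" "\<forall>x\<in>{v..w}. dist (g' x) (f x) < e"
        using P(2) le uw by (auto simp: P_def)
      have "\<forall>x\<in>{u..w}. dist (if x \<le> v then g x else g' x) (f x) < e"
        using g(2) g'(2) by auto
      with dominated_by_increments_glue[OF g(1) g'(1) le]
      show "\<exists>g h. dominated_by_increments u w g h \<and> (\<forall>x\<in>{u..w}. dist (g x) (f x) < e)"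
        by blast
    qed
  next
    fix x assume "a \<le> x" "x \<le> b"
    then have "x \<in> {a..b}" by simp
    from regulated_near_limits[OF reg this \<open>a < b\<close> \<open>0 < e\<close>] obtain l r d where "0 < d" and
      l: "\<And>y. a \<le> y \<Longrightarrow> y < x \<Longrightarrow> x - y < d \<Longrightarrow> dist l (f y) < e" and
      r: "\<And>y. y \<le> b \<Longrightarrow> x < y \<Longrightarrow> y - x < d \<Longrightarrow> dist r (f y) < e"
      by metis
    have "P u v" if "u \<le> x" "x \<le> v" "v - u < d" for u v
      unfolding P_def
    proof (intro impI)
      assume "a \<le> u" "v \<le> b"
      \<comment> \<open>The value at \<open>x\<close> is kept separate, since \<open>f x\<close> may
        differ from both one-sided limits. \<open>h\<close> accumulates the two jumps, and
        \<open>dist l r\<close> is at most their sum.\<close>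
      define g where "g y = (if y < x then l else if y = x then f x else r)" for y
      define h where "h y = (if y < x then 0 else if y = x then dist l (f x)
        else dist l (f x) + dist (f x) r)" for y
      have "dominated_by_increments u v g h"
        unfolding dominated_by_increments_def g_def h_def
        by (auto simp: dist_triangle)
      moreover have "\<forall>y\<in>{u..v}. dist (g y) (f y) < e"
        using l r that \<open>a \<le> u\<close> \<open>v \<le> b\<close> \<open>0 < e\<close> by (auto simp: g_def)
      ultimately show "\<exists>g h. dominated_by_increments u v g h \<and> (\<forall>x\<in>{u..v}. dist (g x) (f x) < e)"
        by blast
    qed
    with \<open>0 < d\<close> show "\<exists>d>0. \<forall>u v. u \<le> x \<and> x \<le> v \<and> v - u < d \<longrightarrow> P u v" by blast
  qed
  then obtain g h where "dominated_by_increments a b g h" "\<forall>x\<in>{a..b}. dist (g x) (f x) < e"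
    by (auto simp: P_def)
  with dominated_by_increments_imp_finite_variation[of a b g h] \<open>a < b\<close> show ?thesis
    by (intro that[of g]) auto
qed

lemma regulated_imp_uniform_limit_of_finite_variation:
  assumes "regulated a b f" "a < b"
  shows "uniform_limit_of_finite_variation a b f"
proof -
  have "\<exists>g. finite_variation a b g \<and> (\<forall>x\<in>{a..b}. dist (g x) (f x) < inverse (real (Suc n)))" for n
    using regulated_approx[OF assms, of "inverse (real (Suc n))"] by (metis inverse_Suc)
  then obtain g where g: "\<And>n. finite_variation a b (g n)"
    "\<And>n x. x \<in> {a..b} \<Longrightarrow> dist (g n x) (f x) < inverse (real (Suc n))"
    by metis
  have "uniform_limit {a..b} g f sequentially"
  proof (rule uniform_limitI)
    fix e :: real assume "0 < e"
    with LIMSEQ_inverse_real_of_nat have "\<forall>\<^sub>F n in sequentially. inverse (real (Suc n)) < e"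
      by (rule order_tendstoD(2))
    then show "\<forall>\<^sub>F n in sequentially. \<forall>x\<in>{a..b}. dist (g n x) (f x) < e"
      by eventually_elim (meson g(2) less_trans)
  qed
  with g(1) show ?thesis
    unfolding uniform_limit_of_finite_variation_def by blast
qed

section \<open>Truncated variation of uniform limits\<close>

lemma uniform_limit_imp_truncated_variation_finite:
  assumes "uniform_limit_of_finite_variation a b f" "a \<le> b" "0 < c"
  shows "truncated_variation c a b f < \<infinity>"
proof -
  obtain G where G: "\<And>n. finite_variation a b (G n)" "uniform_limit {a..b} G f sequentially"
    using assms(1) by (auto simp: uniform_limit_of_finite_variation_def)
  \<comment> \<open>The errors at the two ends of an increment then add up to less than
    \<open>c\<close>, the amount that truncation subtracts.\<close>
  have "\<forall>\<^sub>F n in sequentially. \<forall>x\<in>{a..b}. dist (G n x) (f x) < c / 2"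
    using uniform_limitD[OF G(2), of "c / 2"] \<open>0 < c\<close> by simp
  then obtain N where N: "\<And>x. x \<in> {a..b} \<Longrightarrow> dist (G N x) (f x) < c / 2"
    unfolding eventually_sequentially by blast
  obtain B where B: "\<And>n t. (n, t) \<in> grids a b \<Longrightarrow>
      (\<Sum>i=1..n. dist (G N (t i)) (G N (t (i - 1)))) \<le> B"
    using G(1)[of N] finite_variation_iff[OF \<open>a \<le> b\<close>, of "G N"] by blast
  have "(\<Sum>i=1..n. max (dist (f (t i)) (f (t (i - 1))) - c) 0) \<le> B" if "(n, t) \<in> grids a b" for n t
  proof -
    have "max (dist (f (t i)) (f (t (i - 1))) - c) 0 \<le> dist (G N (t i)) (G N (t (i - 1)))"
      if "i \<in> {1..n}" for i
    proof -
      have "dist (G N (t i)) (f (t i)) < c / 2" "dist (G N (t (i - 1))) (f (t (i - 1))) < c / 2"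
        using N grids_bounds[OF \<open>(n, t) \<in> grids a b\<close>] that by auto
      moreover have "dist (f (t i)) (f (t (i - 1))) \<le> dist (G N (t i)) (f (t i)) +
          dist (G N (t i)) (G N (t (i - 1))) + dist (G N (t (i - 1))) (f (t (i - 1)))"
        by metric
      ultimately show ?thesis by simp
    qed
    then show ?thesis
      using B[OF that] by (meson order_trans sum_mono)
  qed
  then show ?thesis
    using truncated_variation_finite_iff[OF \<open>a \<le> b\<close>] by blast
qed

section \<open>Lower bounds for the truncated variation\<close>

text \<open>A lower bound witnessed by a single grid, in real arithmetic: such witnesses on
  separated intervals can be concatenated, which suits an induction that builds ever larger
  sums.\<close>

definition truncated_reach ::
  "real \<Rightarrow> (real \<Rightarrow> 'a::metric_space) \<Rightarrow> real \<Rightarrow> real \<Rightarrow> real \<Rightarrow> bool" where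
  "truncated_reach c f u v S \<longleftrightarrow>
    (\<exists>(n, t)\<in>grids u v. S \<le> (\<Sum>i=1..n. max (dist (f (t i)) (f (t (i - 1))) - c) 0))"

lemma truncated_reach_mono:
  assumes "truncated_reach c f u v S" "u' \<le> u" "v \<le> v'" "S' \<le> S"
  shows "truncated_reach c f u' v' S'"
proof -
  have "grids u v \<subseteq> grids u' v'"
    using assms(2,3) by (auto simp: grids_def)
  with assms(1,4) show ?thesis
    unfolding truncated_reach_def case_prod_unfold by (meson order_trans subsetD)
qed

lemma truncated_reach_zero:
  assumes "u \<le> v"
  shows "truncated_reach c f u v 0"
proof -
  have "(0, \<lambda>_. u) \<in> grids u v"
    using assms by (auto simp: grids_def intro!: strict_mono_onI)
  then show ?thesis
    unfolding truncated_reach_def by (intro bexI) auto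
qed

lemma truncated_reach_pair:
  assumes "x < y"
  shows "truncated_reach c f x y (dist (f x) (f y) - c)"
proof -
  have "(1, \<lambda>i. if i = 0 then x else y) \<in> grids x y"
    using assms by (auto simp: grids_def intro!: strict_mono_onI)
  then show ?thesis
    unfolding truncated_reach_def by (intro bexI) (auto simp: dist_commute)
qed

lemma truncated_reach_append:
  assumes "truncated_reach c f u v S" "truncated_reach c f v' w S'" "v < v'"
  shows "truncated_reach c f u w (S + S')"
proof -
  let ?D = "\<lambda>t i. max (dist (f (t i)) (f (t (i - 1))) - c) 0"
  obtain n t where t: "(n, t) \<in> grids u v" "S \<le> (\<Sum>i=1..n. ?D t i)"
    using assms(1) by (auto simp: truncated_reach_def)
  obtain m t' where t': "(m, t') \<in> grids v' w" "S' \<le> (\<Sum>i=1..m. ?D t' i)"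
    using assms(2) by (auto simp: truncated_reach_def)
  \<comment> \<open>The \<open>n + 1\<close> points of \<open>t\<close> are followed by the
    \<open>m + 1\<close> points of \<open>t'\<close>, hence the shift by \<open>Suc n\<close> and
    the last index \<open>n + Suc m\<close>.\<close>
  define T where "T i = (if i \<le> n then t i else t' (i - Suc n))" for i
  have sm: "strict_mono_on {0..n} t" "strict_mono_on {0..m} t'"
    using t(1) t'(1) by (auto simp: grids_def)
  have "strict_mono_on {0..n + Suc m} T"
  proof (rule strict_mono_onI)
    fix i j assume ij: "i \<in> {0..n + Suc m}" "j \<in> {0..n + Suc m}" "i < j"
    consider "j \<le> n" | "i \<le> n" "n < j" | "n < i" by linarith
    then show "T i < T j"
    proof cases
      case 1
      then show ?thesis using ij strict_mono_onD[OF sm(1), of i j] by (auto simp: T_def)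
    next
      case 2
      then have "t i \<le> v" "v' \<le> t' (j - Suc n)"
        using grids_bounds[OF t(1), of i] grids_bounds[OF t'(1), of "j - Suc n"] ij by auto
      then show ?thesis using 2 \<open>v < v'\<close> by (simp add: T_def)
    next
      case 3
      then show ?thesis using ij strict_mono_onD[OF sm(2), of "i - Suc n" "j - Suc n"]
        by (auto simp: T_def)
    qed
  qed
  then have "(n + Suc m, T) \<in> grids u w"
    using t(1) t'(1) by (auto simp: grids_def T_def)
  moreover have "S + S' \<le> (\<Sum>i=1..n + Suc m. ?D T i)"
  proof -
    have "(\<Sum>i=1..n. ?D t i) = (\<Sum>i=1..n. ?D T i)"
      by (intro sum.cong) (auto simp: T_def)
    \<comment> \<open>For \<open>i \<ge> 1\<close> the predecessor index
      \<open>i + Suc n - 1\<close> still exceeds \<open>n\<close>, so both points of the increment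
      come from \<open>t'\<close>.\<close>
    moreover have "(\<Sum>i=1..m. ?D t' i) = (\<Sum>i=1..m. ?D T (i + Suc n))"
      by (intro sum.cong) (auto simp: T_def Suc_diff_le)
    moreover have "\<dots> = (\<Sum>i=1 + Suc n..m + Suc n. ?D T i)"
      by (rule sum.shift_bounds_cl_nat_ivl[symmetric])
    moreover have "(\<Sum>i=1..n. ?D T i) + (\<Sum>i=1 + Suc n..m + Suc n. ?D T i)
        = (\<Sum>i\<in>{1..n} \<union> {1 + Suc n..m + Suc n}. ?D T i)"
      by (rule sum.union_disjoint[symmetric]) auto
    \<comment> \<open>Only the index \<open>n + 1\<close> of the bridging increment is missing from
      the union.\<close>
    moreover have "\<dots> \<le> (\<Sum>i=1..n + Suc m. ?D T i)"
      by (rule sum_mono2) auto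
    ultimately show ?thesis using t(2) t'(2) by linarith
  qed
  ultimately show ?thesis
    unfolding truncated_reach_def by blast
qed

lemma truncated_variation_infinite:
  assumes "a \<le> b" "0 < k" "\<And>n::nat. truncated_reach c f a b (real n * k)"
  shows "\<not> truncated_variation c a b f < \<infinity>"
proof
  assume "truncated_variation c a b f < \<infinity>"
  then obtain B where "\<And>n t. (n, t) \<in> grids a b \<Longrightarrow>
      (\<Sum>i=1..n. max (dist (f (t i)) (f (t (i - 1))) - c) 0) \<le> B"
    using truncated_variation_finite_iff[OF \<open>a \<le> b\<close>, of c f] by blast
  then have "real n * k \<le> B" for n
    using assms(3)[of n] unfolding truncated_reach_def by force
  moreover obtain n :: nat where "B < real n * k"
    using reals_Archimedean3[OF \<open>0 < k\<close>] by blast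
  ultimately show False by (meson not_less)
qed

section \<open>One-sided limits from finite truncated variation\<close>

text \<open>In a complete space a proper image filter without a limit is not Cauchy, and negating
  the metric Cauchy criterion gives a fixed gap \<open>e\<close>. Since \<open>e > 0\<close> the two
  points differ, and symmetry of \<open>dist\<close> allows them to be ordered.\<close>

lemma no_limit_imp_oscillation:
  fixes f :: "real \<Rightarrow> 'a::complete_space"
  assumes "\<nexists>l. (f \<longlongrightarrow> l) F" "F \<noteq> bot"
  obtains e where "0 < e" "\<And>P. eventually P F \<Longrightarrow> \<exists>x y. P x \<and> P y \<and> x < y \<and> e \<le> dist (f x) (f y)"
proof -
  have "\<not> cauchy_filter (filtermap f F)"
  proof
    assume "cauchy_filter (filtermap f F)"
    moreover have "filtermap f F \<noteq> bot"
      using \<open>F \<noteq> bot\<close> by (simp add: filtermap_bot_iff)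
    ultimately have "\<exists>l. filtermap f F \<le> nhds l"
      using complete_UNIV[where 'a='a] unfolding complete_uniform by simp
    with assms(1) show False by (simp add: filterlim_def)
  qed
  then obtain e where "0 < e" and
    e: "\<And>P. eventually P F \<Longrightarrow> \<exists>x y. P x \<and> P y \<and> e \<le> dist (f x) (f y)"
    unfolding cauchy_filter_metric_filtermap not_all not_imp not_ex de_Morgan_conj not_less
    by blast
  show ?thesis
  proof (rule that[OF \<open>0 < e\<close>])
    fix P assume "eventually P F"
    then obtain x y where xy: "P x" "P y" "e \<le> dist (f x) (f y)"
      using e by blast
    with \<open>0 < e\<close> have "x \<noteq> y" by auto
    with xy show "\<exists>x y. P x \<and> P y \<and> x < y \<and> e \<le> dist (f x) (f y)"
      by (metis dist_commute neq_iff)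
  qed
qed

text \<open>Oscillation by \<open>e\<close> arbitrarily close to \<open>s\<close> supplies disjoint
  pairs moving towards \<open>s\<close>. At level \<open>e/2\<close> each pair still contributes at
  least \<open>e - e/2 = e/2\<close>, so the sums are unbounded.\<close>

lemma truncated_variation_finite_imp_left_limit:
  fixes f :: "real \<Rightarrow> 'a::complete_space"
  assumes fin: "\<And>c. 0 < c \<Longrightarrow> truncated_variation c a b f < \<infinity>" and "a < s" "s \<le> b"
  shows "\<exists>l. (f \<longlongrightarrow> l) (at_left s)"
proof (rule ccontr)
  assume "\<nexists>l. (f \<longlongrightarrow> l) (at_left s)"
  then obtain e where "0 < e" and osc: "\<And>P. eventually P (at_left s) \<Longrightarrow>
      \<exists>x y. P x \<and> P y \<and> x < y \<and> e \<le> dist (f x) (f y)"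
    by (rule no_limit_imp_oscillation) auto
  \<comment> \<open>Keeping \<open>q\<close> strictly below \<open>s\<close> leaves room for the
    next pair between \<open>q\<close> and \<open>s\<close>.\<close>
  have "\<exists>q<s. truncated_reach (e/2) f a q (real n * (e/2))" for n
  proof (induction n)
    case 0
    then show ?case using \<open>a < s\<close> by (auto intro: truncated_reach_zero)
  next
    case (Suc n)
    then obtain q where q: "q < s" "truncated_reach (e/2) f a q (real n * (e/2))" by blast
    have "eventually (\<lambda>x. q < x \<and> x < s) (at_left s)"
      using q(1) unfolding eventually_at_left_field by blast
    from osc[OF this] obtain x y where xy: "q < x" "x < y" "y < s" "e \<le> dist (f x) (f y)" by blast
    have "truncated_reach (e/2) f a y (real n * (e/2) + (dist (f x) (f y) - e/2))"
      using truncated_reach_append[OF q(2) truncated_reach_pair] xy by blast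
    moreover have "real (Suc n) * (e/2) \<le> real n * (e/2) + (dist (f x) (f y) - e/2)"
      using xy by (simp add: field_simps)
    ultimately have "truncated_reach (e/2) f a y (real (Suc n) * (e/2))"
      by (rule truncated_reach_mono[OF _ order_refl order_refl])
    with xy show ?case by blast
  qed
  then have "truncated_reach (e/2) f a b (real n * (e/2))" for n
    using \<open>s \<le> b\<close> truncated_reach_mono[OF _ order_refl _ order_refl]
    by (meson less_le_trans less_imp_le)
  then show False
    using truncated_variation_infinite[of a b "e/2" "e/2" f] fin[of "e/2"] assms(2,3) \<open>0 < e\<close> by simp
qed

text \<open>Mirror image of the left limit: the pairs now move down towards \<open>s\<close>, so
  each new pair is placed in front of the grid built so far, and the induction tracks its left bound
  \<open>p > s\<close>.\<close>

lemma truncated_variation_finite_imp_right_limit: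
  fixes f :: "real \<Rightarrow> 'a::complete_space"
  assumes fin: "\<And>c. 0 < c \<Longrightarrow> truncated_variation c a b f < \<infinity>" and "a \<le> s" "s < b"
  shows "\<exists>r. (f \<longlongrightarrow> r) (at_right s)"
proof (rule ccontr)
  assume "\<nexists>r. (f \<longlongrightarrow> r) (at_right s)"
  then obtain e where "0 < e" and osc: "\<And>P. eventually P (at_right s) \<Longrightarrow>
      \<exists>x y. P x \<and> P y \<and> x < y \<and> e \<le> dist (f x) (f y)"
    by (rule no_limit_imp_oscillation) auto
  have "\<exists>p>s. truncated_reach (e/2) f p b (real n * (e/2))" for n
  proof (induction n)
    case 0
    then show ?case using \<open>s < b\<close> by (auto intro: truncated_reach_zero)
  next
    case (Suc n)
    then obtain p where p: "s < p" "truncated_reach (e/2) f p b (real n * (e/2))" by blast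
    have "eventually (\<lambda>x. s < x \<and> x < p) (at_right s)"
      using p(1) unfolding eventually_at_right_field by blast
    from osc[OF this] obtain x y where xy: "s < x" "x < y" "y < p" "e \<le> dist (f x) (f y)" by blast
    have "truncated_reach (e/2) f x b (dist (f x) (f y) - e/2 + real n * (e/2))"
      using truncated_reach_append[OF truncated_reach_pair p(2)] xy by blast
    moreover have "real (Suc n) * (e/2) \<le> dist (f x) (f y) - e/2 + real n * (e/2)"
      using xy by (simp add: field_simps)
    ultimately have "truncated_reach (e/2) f x b (real (Suc n) * (e/2))"
      by (rule truncated_reach_mono[OF _ order_refl order_refl])
    with xy show ?case by blast
  qed
  then have "truncated_reach (e/2) f a b (real n * (e/2))" for n
    using \<open>a \<le> s\<close> truncated_reach_mono[OF _ _ order_refl order_refl]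
    by (meson le_less_trans less_imp_le)
  then show False
    using truncated_variation_infinite[of a b "e/2" "e/2" f] fin[of "e/2"] assms(2,3) \<open>0 < e\<close> by simp
qed

theorem fact2p2:
  fixes a b :: real and f :: "real \<Rightarrow> 'a::complete_space"
  assumes "a < b"
  shows "(regulated a b f \<longleftrightarrow> uniform_limit_of_finite_variation a b f) \<and>
         (uniform_limit_of_finite_variation a b f \<longleftrightarrow>
           (\<forall>c>0. truncated_variation c a b f < \<infinity>))"
proof -
  have "uniform_limit_of_finite_variation a b f" if "regulated a b f"
    using regulated_imp_uniform_limit_of_finite_variation[OF that assms] .
  moreover have "\<forall>c>0. truncated_variation c a b f < \<infinity>"
    if "uniform_limit_of_finite_variation a b f"
    using uniform_limit_imp_truncated_variation_finite[OF that] assms by simp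
  moreover have "regulated a b f" if "\<forall>c>0. truncated_variation c a b f < \<infinity>"
    \<comment> \<open>The non-strict bounds \<open>s \<le> b\<close> and \<open>a \<le> s\<close> in
      these two lemmas also cover the limits at the endpoints.\<close>
    using truncated_variation_finite_imp_left_limit[of a b f]
      truncated_variation_finite_imp_right_limit[of a b f] that assms
    unfolding regulated_def by auto
  ultimately show ?thesis by blast
qed

end
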